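(* Let $G=(V,E)$ be a graph with connected medians. Then $G$ is an ABCT-graph and an ABCT$^-$-graph; that is, the median function $\mathrm{Med}$ is the unique consensus function on $G$ satisfying the axioms (A), (B), (C), (T), and it is also the unique consensus function on $G$ satisfying the axioms (A), (B), (C), (T$^-$).
   Context: All graphs are undirected, simple and connected; $d$ denotes the graph distance and $I(u,v)=\{w\in V: d(u,w)+d(w,v)=d(u,v)\}$ the interval between $u$ and $v$. A profile is a finite sequence $\pi=(x_1,\dots,x_n)$ of vertices (repetitions allowed); $V^*$ is the set of all profiles; $\pi\rho$ denotes concatenation, and $(\pi,x)$ or $\pi,x$ denotes appending the vertex $x$. A consensus function is a map $L:V^*\to 2^V\setminus\{\emptyset\}$. For a profile $\pi$, $F_\pi(v)=\sum_{i=1}^n d(v,x_i)$ and $\mathrm{Med}(\pi)$ is the set of vertices minimizing $F_\pi$; the median function is $\pi\mapsto \mathrm{Med}(\pi)$. $G$ has connected medians if for every profile $\pi$, $\mathrm{Med}(\pi)$ induces a connected subgraph of $G$. Axioms for a consensus function $L$: (A) Anonymity: $L(x_1,\dots,x_n)=L(x_{\sigma(1)},\dots,x_{\sigma(n)})$ for every profile and every permutation $\sigma$; (B) Betweenness: $L(u,v)=I(u,v)$ for all $u,v\in V$; (C) Consistency: for all profiles $\pi,\rho$, if $L(\pi)\cap L(\rho)\neq\emptyset$ then $L(\pi\rho)=L(\pi)\cap L(\rho)$; (T) Triangle: for any three pairwise adjacent vertices $u,v,w$, $L(u,v,w)=\{u,v,w\}$; (T$^-$) weak Triangle: for any three pairwise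 adjacent vertices $u,v,w$, if $u\in L(u,v,w)$ then $\{u,v,w\}\subseteq L(u,v,w)$. *)

theory Defs
  imports "HOL-Combinatorics.Permutations"
begin

section \<open>Graphs\<close>

text \<open>A graph is a vertex set \<open>V\<close>, possibly infinite, with a set \<open>E\<close> of two-element subsets of \<open>V\<close>.\<close>

definition simple_graph :: "'a set \<Rightarrow> 'a set set \<Rightarrow> bool" where
  "simple_graph V E \<longleftrightarrow> (\<forall>e\<in>E. e \<subseteq> V \<and> card e = 2)"

definition adjacent :: "'a set set \<Rightarrow> 'a \<Rightarrow> 'a \<Rightarrow> bool" where
  "adjacent E u v \<longleftrightarrow> {u, v} \<in> E"

definition walk_betw :: "'a set \<Rightarrow> 'a set set \<Rightarrow> 'a \<Rightarrow> 'a list \<Rightarrow> 'a \<Rightarrow> bool" where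
  "walk_betw V E u p v \<longleftrightarrow>
     p \<noteq> [] \<and> set p \<subseteq> V \<and> successively (adjacent E) p \<and> hd p = u \<and> last p = v"

definition connected_graph :: "'a set \<Rightarrow> 'a set set \<Rightarrow> bool" where
  "connected_graph V E \<longleftrightarrow> V \<noteq> {} \<and> (\<forall>u\<in>V. \<forall>v\<in>V. \<exists>p. walk_betw V E u p v)"

definition induced_edges :: "'a set set \<Rightarrow> 'a set \<Rightarrow> 'a set set" where
  "induced_edges E S = {e \<in> E. e \<subseteq> S}"

text \<open>The length of a walk is its number of edges, so \<open>length p - 1\<close>. The value is meaningful only
  if \<open>u\<close> and \<open>v\<close> are joined by a walk.\<close>

definition gdist :: "'a set \<Rightarrow> 'a set set \<Rightarrow> 'a \<Rightarrow> 'a \<Rightarrow> nat" where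
  "gdist V E u v = (LEAST n. \<exists>p. walk_betw V E u p v \<and> length p = Suc n)"

definition interval :: "'a set \<Rightarrow> 'a set set \<Rightarrow> 'a \<Rightarrow> 'a \<Rightarrow> 'a set" where
  "interval V E u v = {w \<in> V. gdist V E u w + gdist V E w v = gdist V E u v}"

section \<open>Profiles and medians\<close>

text \<open>The profiles on \<open>V\<close> are the members of \<^term>\<open>lists V\<close>. The empty profile is included. It has
  median set \<open>V\<close>, and on a connected graph (B) and (C) force every consensus function to take
  the value \<open>V\<close> there.\<close>

definition total_dist :: "'a set \<Rightarrow> 'a set set \<Rightarrow> 'a list \<Rightarrow> 'a \<Rightarrow> nat" where
  "total_dist V E \<pi> v = (\<Sum>x\<leftarrow>\<pi>. gdist V E v x)"

definition Med :: "'a set \<Rightarrow> 'a set set \<Rightarrow> 'a list \<Rightarrow> 'a set" where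
  "Med V E \<pi> = {v \<in> V. \<forall>w\<in>V. total_dist V E \<pi> v \<le> total_dist V E \<pi> w}"

definition connected_medians :: "'a set \<Rightarrow> 'a set set \<Rightarrow> bool" where
  "connected_medians V E \<longleftrightarrow>
     (\<forall>\<pi>\<in>lists V. connected_graph (Med V E \<pi>) (induced_edges E (Med V E \<pi>)))"

section \<open>Consensus functions and axioms\<close>

definition consensus_function :: "'a set \<Rightarrow> ('a list \<Rightarrow> 'a set) \<Rightarrow> bool" where
  "consensus_function V L \<longleftrightarrow> (\<forall>\<pi>\<in>lists V. L \<pi> \<subseteq> V \<and> L \<pi> \<noteq> {})"

definition anonymity :: "'a set \<Rightarrow> ('a list \<Rightarrow> 'a set) \<Rightarrow> bool" where
  "anonymity V L \<longleftrightarrow>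
     (\<forall>\<pi>\<in>lists V. \<forall>\<sigma>. \<sigma> permutes {..<length \<pi>} \<longrightarrow> L \<pi> = L (permute_list \<sigma> \<pi>))"

definition betweenness :: "'a set \<Rightarrow> 'a set set \<Rightarrow> ('a list \<Rightarrow> 'a set) \<Rightarrow> bool" where
  "betweenness V E L \<longleftrightarrow> (\<forall>u\<in>V. \<forall>v\<in>V. L [u, v] = interval V E u v)"

definition consistency :: "'a set \<Rightarrow> ('a list \<Rightarrow> 'a set) \<Rightarrow> bool" where
  "consistency V L \<longleftrightarrow>
     (\<forall>\<pi>\<in>lists V. \<forall>\<rho>\<in>lists V. L \<pi> \<inter> L \<rho> \<noteq> {} \<longrightarrow> L (\<pi> @ \<rho>) = L \<pi> \<inter> L \<rho>)"

definition triangle :: "'a set \<Rightarrow> 'a set set \<Rightarrow> ('a list \<Rightarrow> 'a set) \<Rightarrow> bool" where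
  "triangle V E L \<longleftrightarrow>
     (\<forall>u\<in>V. \<forall>v\<in>V. \<forall>w\<in>V. adjacent E u v \<and> adjacent E v w \<and> adjacent E u w \<longrightarrow>
        L [u, v, w] = {u, v, w})"

definition weak_triangle :: "'a set \<Rightarrow> 'a set set \<Rightarrow> ('a list \<Rightarrow> 'a set) \<Rightarrow> bool" where
  "weak_triangle V E L \<longleftrightarrow>
     (\<forall>u\<in>V. \<forall>v\<in>V. \<forall>w\<in>V. adjacent E u v \<and> adjacent E v w \<and> adjacent E u w \<longrightarrow>
        u \<in> L [u, v, w] \<longrightarrow> {u, v, w} \<subseteq> L [u, v, w])"

definition ABCT_function :: "'a set \<Rightarrow> 'a set set \<Rightarrow> ('a list \<Rightarrow> 'a set) \<Rightarrow> bool" where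
  "ABCT_function V E L \<longleftrightarrow> consensus_function V L \<and>
     anonymity V L \<and> betweenness V E L \<and> consistency V L \<and> triangle V E L"

definition ABCT_minus_function :: "'a set \<Rightarrow> 'a set set \<Rightarrow> ('a list \<Rightarrow> 'a set) \<Rightarrow> bool" where
  "ABCT_minus_function V E L \<longleftrightarrow> consensus_function V L \<and>
     anonymity V L \<and> betweenness V E L \<and> consistency V L \<and> weak_triangle V E L"

text \<open>HOL functions also have values on lists outside \<^term>\<open>lists V\<close>, so uniqueness means agreement
  on all profiles.\<close>

definition ABCT_graph :: "'a set \<Rightarrow> 'a set set \<Rightarrow> bool" where
  "ABCT_graph V E \<longleftrightarrow> ABCT_function V E (Med V E) \<and>
     (\<forall>L. ABCT_function V E L \<longrightarrow> (\<forall>\<pi>\<in>lists V. L \<pi> = Med V E \<pi>))"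

definition ABCT_minus_graph :: "'a set \<Rightarrow> 'a set set \<Rightarrow> bool" where
  "ABCT_minus_graph V E \<longleftrightarrow> ABCT_minus_function V E (Med V E) \<and>
     (\<forall>L. ABCT_minus_function V E L \<longrightarrow> (\<forall>\<pi>\<in>lists V. L \<pi> = Med V E \<pi>))"

end

theory Submission
  imports Complex_Main Defs
begin

text \<open>
  Let \<open>L\<close> satisfy (A), (B), (C) and the weak triangle axiom. The key step is that for an edge \<open>uv\<close> and a
  vertex \<open>z\<close> equidistant from its ends, \<open>L(u,v,z)\<close> contains \<open>u\<close> and \<open>v\<close>. To refute some other
  \<open>y \<in> L(u,v,z)\<close>, append copies of \<open>y\<close> to the profile, which forces the value \<open>{y}\<close>, and split the
  result into pairs that all have another vertex in common. Connectedness of medians enters through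
  the triangle condition: there is a common neighbour of \<open>u\<close> and \<open>v\<close> one step closer to \<open>z\<close>.

  It follows that if \<open>u \<in> L(\<pi>)\<close> and a neighbour \<open>v\<close> satisfies \<open>F\<^sub>\<pi>(v) \<le> F\<^sub>\<pi>(u)\<close>, then equality holds
  and \<open>v \<in> L(\<pi>)\<close>. Hence \<open>L(\<pi>)\<close> consists of local minima of \<open>F\<^sub>\<pi>\<close>, which are global minima when
  medians are connected, and \<open>L(\<pi>)\<close> is closed under adjacency in the connected set \<open>Med(\<pi>)\<close>.
\<close>

section \<open>The graph metric\<close>

locale conn_graph =
  fixes V :: "'a set" and E :: "'a set set"
  assumes simple: "simple_graph V E" and conn: "connected_graph V E"
begin

abbreviation d :: "'a \<Rightarrow> 'a \<Rightarrow> nat" where "d \<equiv> gdist V E"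
abbreviation F :: "'a list \<Rightarrow> 'a \<Rightarrow> nat" where "F \<equiv> total_dist V E"
abbreviation M :: "'a list \<Rightarrow> 'a set" where "M \<equiv> Med V E"
abbreviation I :: "'a \<Rightarrow> 'a \<Rightarrow> 'a set" where "I \<equiv> interval V E"

lemma geodesic_exists:
  assumes "u \<in> V" "v \<in> V"
  obtains p where "walk_betw V E u p v" "length p = Suc (d u v)"
proof -
  obtain p where p: "walk_betw V E u p v"
    using assms conn unfolding connected_graph_def by blast
  then have "\<exists>n. \<exists>p. walk_betw V E u p v \<and> length p = Suc n"
    by (intro exI[of _ "length p - 1"] exI[of _ p]) (auto simp: walk_betw_def)
  from LeastI_ex[OF this] show thesis
    using that unfolding gdist_def by blast
qed

lemma gdist_le_walk:
  assumes "walk_betw V E u p v"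
  shows "d u v \<le> length p - 1"
  unfolding gdist_def using assms by (intro Least_le) (auto simp: walk_betw_def)

lemma gdist_self [simp]: "u \<in> V \<Longrightarrow> d u u = 0"
  using gdist_le_walk[of u "[u]" u] by (simp add: walk_betw_def)

lemma gdist_eq_0: "u \<in> V \<Longrightarrow> v \<in> V \<Longrightarrow> d u v = 0 \<longleftrightarrow> u = v"
proof
  assume "u \<in> V" "v \<in> V" "d u v = 0"
  then obtain p where "walk_betw V E u p v" "length p = Suc 0"
    by (metis geodesic_exists)
  then show "u = v"
    by (auto simp: walk_betw_def length_Suc_conv)
qed auto

lemma adjacent_sym: "adjacent E u v \<longleftrightarrow> adjacent E v u"
  by (simp add: adjacent_def insert_commute)

lemma gdist_sym:
  assumes "u \<in> V" "v \<in> V"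
  shows "d u v = d v u"
proof -
  have "d v u \<le> d u v" if uv: "u \<in> V" "v \<in> V" for u v
  proof -
    obtain p where p: "walk_betw V E u p v" "length p = Suc (d u v)"
      using geodesic_exists[OF uv] .
    then have "walk_betw V E v (rev p) u"
      by (auto simp: walk_betw_def hd_rev last_rev successively_rev adjacent_sym)
    from gdist_le_walk[OF this] show ?thesis
      using p by simp
  qed
  with assms show ?thesis
    by (simp add: antisym)
qed

lemma gdist_triangle:
  assumes "u \<in> V" "v \<in> V" "w \<in> V"
  shows "d u w \<le> d u v + d v w"
proof -
  obtain p where p: "walk_betw V E u p v" "length p = Suc (d u v)"
    using geodesic_exists assms by blast
  obtain q where q: "walk_betw V E v q w" "length q = Suc (d v w)"
    using geodesic_exists assms by blast
  obtain q' where q': "q = v # q'"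
    using q by (cases q) (auto simp: walk_betw_def)
  have "walk_betw V E u (p @ q') w"
    using p q unfolding q'
    by (cases q') (auto simp: walk_betw_def successively_append_iff successively_Cons)
  from gdist_le_walk[OF this] show ?thesis
    using p q q' by simp
qed

lemma adjacent_iff_gdist:
  assumes "u \<in> V" "v \<in> V"
  shows "adjacent E u v \<longleftrightarrow> d u v = 1"
proof
  assume a: "adjacent E u v"
  then have "u \<noteq> v"
    using simple by (auto simp: adjacent_def simple_graph_def)
  moreover have "d u v \<le> 1"
    using gdist_le_walk[of u "[u, v]" v] a assms by (simp add: walk_betw_def)
  ultimately show "d u v = 1"
    using gdist_eq_0[OF assms] by linarith
next
  assume "d u v = 1"
  then obtain p where "walk_betw V E u p v" "length p = Suc (Suc 0)"
    using geodesic_exists[OF assms] by (metis One_nat_def)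
  then show "adjacent E u v"
    by (auto simp: walk_betw_def length_Suc_conv)
qed

lemma interval_adjacent:
  assumes "u \<in> V" "v \<in> V" "d u v = 1"
  shows "I u v = {u, v}"
proof -
  have "w = u \<or> w = v" if "w \<in> V" "d u w + d w v = 1" for w
    using that gdist_eq_0[of u w] gdist_eq_0[of w v] assms by (auto simp: add_is_1)
  then show ?thesis
    using assms by (auto simp: interval_def)
qed

lemma interval_self: "u \<in> V \<Longrightarrow> I u u = {u}"
  by (auto simp: interval_def gdist_eq_0)

lemma interval_ends: "u \<in> V \<Longrightarrow> v \<in> V \<Longrightarrow> u \<in> I u v \<and> v \<in> I u v"
  by (simp add: interval_def)

section \<open>The median function satisfies the axioms\<close>

lemma total_dist_simps [simp]:
  "F [] v = 0" "F (x # \<pi>) v = d v x + F \<pi> v" "F (\<pi> @ \<rho>) v = F \<pi> v + F \<rho> v"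
  "F (replicate n x) v = n * d v x" "F (concat (replicate n \<pi>)) v = n * F \<pi> v"
  by (simp_all add: total_dist_def sum_list_replicate) (induct n; simp)

lemma Med_nonempty: "M \<pi> \<noteq> {}"
proof -
  obtain v0 where "v0 \<in> V"
    using conn by (auto simp: connected_graph_def)
  then obtain v where "v \<in> V" "\<forall>w. w \<in> V \<longrightarrow> F \<pi> v \<le> F \<pi> w"
    using ex_has_least_nat[of "\<lambda>v. v \<in> V" v0 "F \<pi>"] by blast
  then show ?thesis
    by (auto simp: Med_def)
qed

lemma Med_consensus: "consensus_function V M"
  using Med_nonempty by (auto simp: consensus_function_def Med_def)

lemma Med_anonymity: "anonymity V M"
proof -
  have "F (permute_list \<sigma> \<pi>) = F \<pi>" if "\<sigma> permutes {..<length \<pi>}" for \<sigma> \<pi>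
  proof
    fix v
    show "F (permute_list \<sigma> \<pi>) v = F \<pi> v"
      unfolding total_dist_def sum_mset_sum_list[symmetric] mset_map
      using that by simp
  qed
  then show ?thesis
    by (simp add: anonymity_def Med_def)
qed

lemma Med_betweenness: "betweenness V E M"
proof -
  have "M [u, v] = I u v" if uv: "u \<in> V" "v \<in> V" for u v
  proof -
    have F: "F [u, v] w = d u w + d w v" if "w \<in> V" for w
      using that uv by (simp add: gdist_sym)
    have ge: "d u v \<le> d u w + d w v" if "w \<in> V" for w
      using that uv gdist_triangle by blast
    have "w \<in> M [u, v] \<longleftrightarrow> w \<in> I u v" for w
    proof
      assume "w \<in> M [u, v]"
      then have w: "w \<in> V" and "F [u, v] w \<le> F [u, v] u"
        using uv by (auto simp: Med_def)
      then show "w \<in> I u v"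
        using F[OF w] F[OF uv(1)] ge[OF w] uv by (simp add: interval_def)
    next
      assume "w \<in> I u v"
      then show "w \<in> M [u, v]"
        using F ge by (simp add: interval_def Med_def del: total_dist_simps)
    qed
    then show ?thesis by blast
  qed
  then show ?thesis
    by (simp add: betweenness_def)
qed

lemma Med_consistency: "consistency V M"
  unfolding consistency_def
proof (intro ballI impI)
  fix \<pi> \<rho> assume "M \<pi> \<inter> M \<rho> \<noteq> {}"
  then obtain x where x: "x \<in> M \<pi>" "x \<in> M \<rho>" by auto
  show "M (\<pi> @ \<rho>) = M \<pi> \<inter> M \<rho>"
  proof
    show "M \<pi> \<inter> M \<rho> \<subseteq> M (\<pi> @ \<rho>)"
      by (auto simp: Med_def add_mono)
    show "M (\<pi> @ \<rho>) \<subseteq> M \<pi> \<inter> M \<rho>"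
    proof
      fix y assume y: "y \<in> M (\<pi> @ \<rho>)"
      then have "F \<pi> y + F \<rho> y \<le> F \<pi> x + F \<rho> x" "F \<pi> x \<le> F \<pi> y" "F \<rho> x \<le> F \<rho> y"
        using x by (auto simp: Med_def)
      then have "F \<pi> y = F \<pi> x" "F \<rho> y = F \<rho> x" by auto
      then show "y \<in> M \<pi> \<inter> M \<rho>"
        using x y by (auto simp: Med_def)
    qed
  qed
qed

text \<open>Each corner has total distance 2, every other vertex at least 3.\<close>

lemma Med_triangle: "triangle V E M"
  unfolding triangle_def
proof (intro ballI impI)
  fix u v w assume V: "u \<in> V" "v \<in> V" "w \<in> V"
    and "adjacent E u v \<and> adjacent E v w \<and> adjacent E u w"
  then have d: "d u v = 1" "d v u = 1" "d v w = 1" "d w v = 1" "d u w = 1" "d w u = 1"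
    by (auto simp: adjacent_iff_gdist gdist_sym)
  have "F [u, v, w] x \<ge> 3" if "x \<in> V" "x \<notin> {u, v, w}" for x
  proof -
    have "d x u \<noteq> 0" "d x v \<noteq> 0" "d x w \<noteq> 0"
      using that V by (auto simp: gdist_eq_0)
    then show ?thesis by simp
  qed
  moreover have "F [u, v, w] x = 2" if "x \<in> {u, v, w}" for x
    using that V d by auto
  ultimately show "M [u, v, w] = {u, v, w}"
    unfolding Med_def using V by (fastforce simp del: total_dist_simps)
qed

lemma triangle_imp_weak_triangle: "triangle V E L \<Longrightarrow> weak_triangle V E L"
  by (simp add: triangle_def weak_triangle_def)

end

section \<open>Consequences of connected medians\<close>

locale conn_median_graph = conn_graph +
  assumes conn_med: "connected_medians V E"
begin

text \<open>Induction along a walk inside \<open>M \<pi>\<close>; connectedness of medians enters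
  only in this form. With \<open>P q\<close> taken as \<open>q = x\<close>, it shows that a median
  without neighbouring medians is the only one.\<close>

lemma Med_propagate:
  assumes \<pi>: "\<pi> \<in> lists V" and x: "x \<in> M \<pi>" "P x" and y: "y \<in> M \<pi>"
    and step: "\<And>u v. u \<in> M \<pi> \<Longrightarrow> v \<in> M \<pi> \<Longrightarrow> d u v = 1 \<Longrightarrow> P u \<Longrightarrow> P v"
  shows "P y"
proof -
  let ?A = "induced_edges E (M \<pi>)"
  have P: "P (last p)"
    if "p \<noteq> []" "set p \<subseteq> M \<pi>" "successively (adjacent ?A) p" "P (hd p)" for p
    using that
  proof (induct p rule: induct_list012)
    case (3 a b p)
    have "adjacent E a b" "a \<in> M \<pi>" "b \<in> M \<pi>"
      using 3 by (auto simp: adjacent_def induced_edges_def)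
    then have "P b"
      using step[of a b] 3(6) adjacent_iff_gdist[of a b] by (auto simp: Med_def)
    then show ?case
      using 3 by auto
  qed auto
  obtain p where "walk_betw (M \<pi>) ?A x p y"
    using conn_med \<pi> x y unfolding connected_medians_def connected_graph_def by blast
  with P[of p] x show ?thesis
    by (auto simp: walk_betw_def)
qed

text \<open>Otherwise take a vertex \<open>p\<close> of \<open>I u z \<inter> I v z\<close> nearest to the edge, at distance \<open>j \<ge> 2\<close>: then
  \<open>p\<close> is isolated in the median set of \<open>u\<^sup>j v\<^sup>j p\<^sup>2\<^sup>j\<^sup>-\<^sup>1\<close>, which also contains \<open>u\<close>.\<close>

lemma triangle_condition:
  assumes V: "u \<in> V" "v \<in> V" "z \<in> V" and uv: "d u v = 1" and eq: "d u z = d v z"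
  obtains w where "w \<in> V" "d u w = 1" "d v w = 1" "Suc (d w z) = d u z"
proof -
  let ?C = "\<lambda>p. p \<in> V \<and> d u p \<ge> 1 \<and> d u p = d v p \<and> d u p + d p z = d u z"
  have "d u z \<ge> 1"
    using V uv eq gdist_eq_0[of u z] gdist_eq_0[of v z] gdist_eq_0[of u v]
    by (metis less_one not_le zero_neq_one)
  then have "?C z"
    using V eq by simp
  then obtain p where p: "?C p" and min: "\<And>q. ?C q \<Longrightarrow> d u p \<le> d u q"
    using ex_has_least_nat[of ?C z "d u"] by blast
  define j where "j = d u p"
  have pj: "p \<in> V" "d u p = j" "d v p = j" "d p u = j" "d p v = j" "j \<ge> 1"
    using p V gdist_sym by (auto simp: j_def)
  have "j = 1"
  proof (rule ccontr)
    assume "j \<noteq> 1"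
    then have j2: "j \<ge> 2" using pj by simp
    \<comment> \<open>The multiplicity \<open>2 * j - 1\<close> makes the totals at \<open>u\<close>
      and at \<open>p\<close> agree, both being \<open>2 * j * j\<close>.\<close>
    let ?\<pi> = "replicate j u @ replicate j v @ replicate (2 * j - 1) p"
    have prof: "?\<pi> \<in> lists V"
      using V pj by auto
    have Fq: "int (F ?\<pi> q) = int j * (int (d q u) + int (d q v)) + (2 * int j - 1) * int (d q p)" for q
    proof -
      have "int (2 * j - 1) = 2 * int j - 1"
        using pj by simp
      then show ?thesis
        by (simp only: total_dist_simps of_nat_add of_nat_mult) (simp add: algebra_simps)
    qed
    \<comment> \<open>Failure would make both triangle inequalities through \<open>q\<close> tight.
      Then \<open>q\<close> is equidistant from \<open>u\<close> and \<open>v\<close>, satisfies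
      \<open>?C\<close> and is nearer to the edge than \<open>p\<close>, against minimality.\<close>
    have far: "2 * j + 1 \<le> d q u + d q v + 2 * d q p" if q: "q \<in> V" "q \<noteq> p" for q
    proof (rule ccontr)
      assume "\<not> ?thesis"
      moreover have "j \<le> d q u + d q p" "j \<le> d q v + d q p"
        using gdist_triangle[of u q p] gdist_triangle[of v q p] q V pj
        by (auto simp: gdist_sym)
      ultimately have e: "d q u + d q p = j" "d q v + d q p = j" by auto
      have s: "d u q = d q u" "d v q = d q v"
        using q V gdist_sym by auto
      have "d u q \<noteq> 0"
      proof
        assume "d u q = 0"
        with e s have "u = q" "v = q"
          using gdist_eq_0[of u q] gdist_eq_0[of v q] q V by auto
        with uv V show False by simp
      qed
      moreover have "d u q + d q z = d u z"
        using gdist_triangle[of u q z] gdist_triangle[of q p z] q V pj p e s by auto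
      ultimately have "j \<le> d u q"
        using min[of q] e s q by (auto simp: j_def)
      then have "d q p = 0" using e s by simp
      then show False using q pj gdist_eq_0 by auto
    qed
    have pos: "d q u + d q v \<ge> 1" if "q \<in> V" for q
      using gdist_triangle[of u q v] uv that V gdist_sym by auto
    have Fp: "int (F ?\<pi> p) = 2 * int j * int j" and Fu: "int (F ?\<pi> u) = 2 * int j * int j"
      unfolding Fq using pj V uv by (simp_all add: algebra_simps)
    have lower: "2 * int j * int j \<le> int (F ?\<pi> q)" if q: "q \<in> V" for q
    proof (cases "q = p")
      case False
      define s e where "s = int (d q u) + int (d q v)" and "e = int (d q p)"
      have h: "s \<ge> 2 * int j + 1 - 2 * e" "s \<ge> 1"
        using far[OF q False] pos[OF q] by (auto simp: s_def e_def)
      have F: "int (F ?\<pi> q) = int j * s + (2 * int j - 1) * e"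
        unfolding Fq s_def e_def ..
      \<comment> \<open>The first bound on \<open>s\<close> gives a total of at least
        \<open>2 * int j * int j + int j - e\<close>, enough for \<open>e \<le> int j\<close>; for
        larger \<open>e\<close> the bound \<open>s \<ge> 1\<close> is enough.\<close>
      show ?thesis
      proof (cases "e \<le> int j")
        case True
        have "int j * (2 * int j + 1 - 2 * e) \<le> int j * s"
          using h by (intro mult_left_mono) auto
        with True show ?thesis
          unfolding F by (simp add: algebra_simps)
      next
        case False
        have "int j * 1 \<le> int j * s"
          using h by (intro mult_left_mono) auto
        moreover have "(2 * int j - 1) * int j \<le> (2 * int j - 1) * e"
          using False j2 by (intro mult_left_mono) auto
        ultimately show ?thesis
          unfolding F by (simp add: algebra_simps)
      qed
    qed (simp only: Fp order_refl)
    have Med_iff: "q \<in> M ?\<pi> \<longleftrightarrow> q \<in> V \<and> int (F ?\<pi> q) \<le> 2 * int j * int j" for q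
    proof
      assume "q \<in> M ?\<pi>"
      then have "q \<in> V" "F ?\<pi> q \<le> F ?\<pi> p"
        unfolding Med_def using pj by auto
      then show "q \<in> V \<and> int (F ?\<pi> q) \<le> 2 * int j * int j"
        unfolding Fp[symmetric] of_nat_le_iff by blast
    next
      assume q: "q \<in> V \<and> int (F ?\<pi> q) \<le> 2 * int j * int j"
      have "F ?\<pi> q \<le> F ?\<pi> w" if "w \<in> V" for w
        using lower[OF that] q by linarith
      then show "q \<in> M ?\<pi>" using q unfolding Med_def by blast
    qed
    have "u = p"
    proof (rule Med_propagate[OF prof, where P = "\<lambda>q. q = p" and x = p])
      show "p \<in> M ?\<pi>" "u \<in> M ?\<pi>"
        unfolding Med_iff Fp Fu using pj V by auto
      fix a q assume a: "a = p" "d a q = 1" and q: "q \<in> M ?\<pi>"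
      show "q = p"
      proof (rule ccontr)
        assume ne: "q \<noteq> p"
        have qV: "q \<in> V" using q by (simp add: Med_def)
        have e: "d q p = 1"
          using a qV pj gdist_sym by metis
        \<comment> \<open>The total at a neighbour of \<open>p\<close> is at least
          \<open>2 * int j * int j + int j - 1\<close>, which is too large since
          \<open>j \<ge> 2\<close>.\<close>
        have "int j * (2 * int j - 1) \<le> int j * (int (d q u) + int (d q v))"
          using far[OF qV ne] e by (intro mult_left_mono) auto
        then have "2 * int j * int j < int (F ?\<pi> q)"
          unfolding Fq e using j2 by (simp add: algebra_simps)
        with q show False unfolding Med_iff by simp
      qed
    qed simp
    with pj V show False by simp
  qed
  with p pj that[of p] show thesis by auto
qed

text \<open>If \<open>u\<close> were not a global minimum, let \<open>A / B\<close> be the largest slope of descent from \<open>u\<close>. The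
  profile \<open>\<pi>\<^sup>B u\<^sup>A\<close> then has \<open>u\<close> and a vertex other than \<open>u\<close> as medians, so by connectedness
  some neighbour of \<open>u\<close> is a median as well, and it has smaller \<open>F \<pi>\<close>.\<close>

lemma local_min_is_median:
  assumes \<pi>: "\<pi> \<in> lists V" and u: "u \<in> V"
    and loc: "\<And>v. v \<in> V \<Longrightarrow> d u v = 1 \<Longrightarrow> F \<pi> u \<le> F \<pi> v"
  shows "u \<in> M \<pi>"
proof (rule ccontr)
  assume "u \<notin> M \<pi>"
  then obtain w0 where w0: "w0 \<in> V" "F \<pi> w0 < F \<pi> u"
    using u by (auto simp: Med_def not_le)
  define S where "S = {w \<in> V. F \<pi> w < F \<pi> u}"
  define sl where "sl w = rat_of_nat (F \<pi> u - F \<pi> w) / rat_of_nat (d u w)" for w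
  obtain x \<pi>' where x: "\<pi> = x # \<pi>'" "x \<in> V"
    using \<pi> w0 by (cases \<pi>) auto
  \<comment> \<open>\<open>V\<close> may be infinite, but on \<open>S\<close> numerators and
    denominators of the slopes are bounded, so a largest slope exists.\<close>
  have bound: "d u w \<le> 2 * F \<pi> u" if "w \<in> S" for w
  proof -
    have "d u w \<le> d u x + d w x"
      using gdist_triangle[of u x w] gdist_sym[of x w] that x u by (auto simp: S_def)
    moreover have "d u x \<le> F \<pi> u" "d w x \<le> F \<pi> w"
      by (simp_all add: x)
    ultimately show ?thesis
      using that by (auto simp: S_def)
  qed
  have "sl ` S \<subseteq> (\<lambda>(a, b). rat_of_nat a / rat_of_nat b) ` ({..F \<pi> u} \<times> {..2 * F \<pi> u})"
    using bound by (force simp: sl_def)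
  then have fin: "finite (sl ` S)"
    by (rule finite_subset) auto
  have "Max (sl ` S) \<in> sl ` S"
    using fin w0 by (intro Max_in) (auto simp: S_def)
  then obtain w where w: "w \<in> S" "sl w = Max (sl ` S)" by auto
  define A B where "A = F \<pi> u - F \<pi> w" and "B = d u w"
  have AB: "A > 0" "B > 0"
    using w u gdist_eq_0[of u w] by (auto simp: S_def A_def B_def)
  let ?\<rho> = "concat (replicate B \<pi>) @ replicate A u"
  have \<rho>: "?\<rho> \<in> lists V"
    using \<pi> u by auto
  have F\<rho>: "F ?\<rho> y = B * F \<pi> y + A * d u y" if "y \<in> V" for y
    using that u by (simp add: gdist_sym)
  have ge: "B * F \<pi> u \<le> F ?\<rho> y" if y: "y \<in> V" for y
  proof (cases "y \<in> S")
    case True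
    have pos: "d u y > 0"
      using True u gdist_eq_0[of u y] by (auto simp: S_def)
    have "sl y \<le> sl w"
      using fin True w by simp
    then have "rat_of_nat (F \<pi> u - F \<pi> y) / rat_of_nat (d u y) \<le> rat_of_nat A / rat_of_nat B"
      by (simp add: sl_def A_def B_def)
    then have "rat_of_nat (B * (F \<pi> u - F \<pi> y)) \<le> rat_of_nat (A * d u y)"
      using pos AB by (simp add: field_simps)
    then have "B * (F \<pi> u - F \<pi> y) \<le> A * d u y"
      by (simp only: of_nat_le_iff)
    then show ?thesis
      using True unfolding F\<rho>[OF y] by (simp add: S_def diff_mult_distrib2)
  next
    case False
    then have "B * F \<pi> u \<le> B * F \<pi> y"
      using y by (intro mult_left_mono) (auto simp: S_def)
    then show ?thesis
      unfolding F\<rho>[OF y] by (rule trans_le_add1)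
  qed
  have wV: "w \<in> V" using w by (simp add: S_def)
  have Fu: "F ?\<rho> u = B * F \<pi> u"
    unfolding F\<rho>[OF u] using u by simp
  have "F \<pi> w + A = F \<pi> u"
    using w by (simp add: S_def A_def)
  then have Fw: "F ?\<rho> w = B * F \<pi> u"
    unfolding F\<rho>[OF wV] by (metis B_def add_mult_distrib2 mult.commute)
  have med: "u \<in> M ?\<rho>" "w \<in> M ?\<rho>"
    unfolding Med_def using u wV ge Fu Fw by (simp_all del: total_dist_simps)
  have "w = u"
  proof (rule Med_propagate[OF \<rho> med(1) _ med(2), where P = "\<lambda>q. q = u"])
    fix a q assume a: "a = u" "d a q = 1" and q: "q \<in> M ?\<rho>"
    have qV: "q \<in> V" and "F ?\<rho> q \<le> F ?\<rho> u"
      using q u by (auto simp: Med_def)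
    then have "B * F \<pi> q + A \<le> B * F \<pi> u"
      unfolding F\<rho>[OF qV] Fu using a by simp
    moreover have "B * F \<pi> u \<le> B * F \<pi> q"
      using loc[OF qV] a by simp
    ultimately show "q = u"
      using AB by simp
  qed simp
  with w show False by (simp add: S_def)
qed

end

section \<open>Consensus functions on graphs with connected medians\<close>

locale ABCT_minus_consensus = conn_median_graph +
  fixes L :: "'a list \<Rightarrow> 'a set"
  assumes L: "ABCT_minus_function V E L"
begin

section \<open>Basic consequences of the axioms\<close>

lemma L_nonempty: "\<pi> \<in> lists V \<Longrightarrow> L \<pi> \<noteq> {}"
  and L_subset: "\<pi> \<in> lists V \<Longrightarrow> L \<pi> \<subseteq> V"
  using L by (auto simp: ABCT_minus_function_def consensus_function_def)

lemma L_pair: "u \<in> V \<Longrightarrow> v \<in> V \<Longrightarrow> L [u, v] = I u v"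
  using L by (auto simp: ABCT_minus_function_def betweenness_def)

lemma L_append:
  "\<pi> \<in> lists V \<Longrightarrow> \<rho> \<in> lists V \<Longrightarrow> x \<in> L \<pi> \<Longrightarrow> x \<in> L \<rho> \<Longrightarrow> L (\<pi> @ \<rho>) = L \<pi> \<inter> L \<rho>"
  using L unfolding ABCT_minus_function_def consistency_def by blast

lemma L_mset_cong:
  assumes "\<pi> \<in> lists V" "mset \<pi> = mset \<rho>"
  shows "L \<pi> = L \<rho>"
proof -
  obtain \<sigma> where \<sigma>: "\<sigma> permutes {..<length \<pi>}" "permute_list \<sigma> \<pi> = \<rho>"
    using mset_eq_permutation[OF assms(2)[symmetric]] by blast
  have "anonymity V L"
    using L by (simp add: ABCT_minus_function_def)
  with assms(1) \<sigma> show ?thesis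
    unfolding anonymity_def by blast
qed

text \<open>Anonymity and consistency in one rule. The arguments below evaluate a single profile
  through two different splittings and compare the results.\<close>

lemma L_combine:
  assumes "\<sigma> \<in> lists V" "mset \<sigma> = mset \<pi> + mset \<rho>" "x \<in> L \<pi>" "x \<in> L \<rho>"
  shows "L \<sigma> = L \<pi> \<inter> L \<rho>"
proof -
  have m: "mset \<sigma> = mset (\<pi> @ \<rho>)"
    using assms by simp
  then have "set \<sigma> = set (\<pi> @ \<rho>)"
    by (rule mset_eq_setD)
  then have "\<pi> \<in> lists V" "\<rho> \<in> lists V"
    using assms(1) by (auto simp: lists_eq_set)
  with L_append assms(3,4) L_mset_cong[OF assms(1) m] show ?thesis
    by simp
qed

lemma L_single:
  assumes "v \<in> V"
  shows "L [v] = {v}"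
proof -
  obtain x where "x \<in> L [v]"
    using L_nonempty[of "[v]"] assms by auto
  then have "L [v, v] = L [v] \<inter> L [v]"
    using assms by (intro L_combine[where x = x]) auto
  then show ?thesis
    using assms by (simp add: L_pair interval_self)
qed

text \<open>If \<open>y\<close> is in \<open>L []\<close>, splitting off the empty profile from
  \<open>[y, w]\<close> puts the whole interval, and so \<open>w\<close>, into
  \<open>L []\<close>.\<close>

lemma L_Nil: "L [] = V"
proof
  obtain y where y: "y \<in> L []"
    using L_nonempty[of "[]"] by auto
  then have yV: "y \<in> V"
    using L_subset[of "[]"] by auto
  show "V \<subseteq> L []"
  proof
    fix w assume w: "w \<in> V"
    then have "L [y, w] = L [] \<inter> L [y, w]"
      using y yV by (intro L_combine[where x = y]) (auto simp: L_pair interval_ends)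
    moreover have "w \<in> L [y, w]"
      using w yV by (simp add: L_pair interval_ends)
    ultimately show "w \<in> L []" by blast
  qed
qed (use L_subset[of "[]"] in auto)

text \<open>By anonymity any corner can play the role of \<open>u\<close> in the axiom.\<close>

lemma L_weak_triangle:
  assumes "u \<in> V" "v \<in> V" "w \<in> V" "d u v = 1" "d v w = 1" "d u w = 1"
    and "L [u, v, w] \<inter> {u, v, w} \<noteq> {}"
  shows "{u, v, w} \<subseteq> L [u, v, w]"
proof -
  have wt: "{a, b, c} \<subseteq> L [a, b, c]"
    if "a \<in> V" "b \<in> V" "c \<in> V" "d a b = 1" "d b c = 1" "d a c = 1" "a \<in> L [a, b, c]" for a b c
    using L that unfolding ABCT_minus_function_def weak_triangle_def
    by (auto simp: adjacent_iff_gdist)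
  have eq: "L [u, v, w] = L [v, u, w]" "L [u, v, w] = L [w, u, v]"
    using assms by (auto intro!: L_mset_cong)
  have sym: "d v u = 1" "d w v = 1" "d w u = 1"
    using assms gdist_sym by metis+
  consider "u \<in> L [u, v, w]" | "v \<in> L [v, u, w]" | "w \<in> L [w, u, v]"
    using assms(7) eq by blast
  then show ?thesis
  proof cases
    case 1
    with wt[of u v w] assms show ?thesis by blast
  next
    case 2
    with wt[of v u w] assms sym have "{v, u, w} \<subseteq> L [v, u, w]" by blast
    with eq(1) show ?thesis by blast
  next
    case 3
    with wt[of w u v] assms sym have "{w, u, v} \<subseteq> L [w, u, v]" by blast
    with eq(2) show ?thesis by blast
  qed
qed

section \<open>Values on triples containing an edge\<close>

text \<open>Otherwise \<open>u\<close> lies between \<open>v\<close> and \<open>y\<close>. Then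
  \<open>[u, v, z, y]\<close> has value \<open>{y}\<close> when \<open>y\<close> is split off, while
  the pairs \<open>[v, y]\<close> and \<open>[z, u]\<close> have \<open>u\<close> in common.\<close>

lemma L_triple_dist_le:
  assumes V: "u \<in> V" "v \<in> V" "z \<in> V" and uv: "d u v = 1"
    and y: "y \<in> L [u, v, z]" and ne: "y \<noteq> u"
  shows "d y v \<le> d y u"
proof (rule ccontr)
  assume lt: "\<not> ?thesis"
  have yV: "y \<in> V"
    using L_subset[of "[u, v, z]"] V y by auto
  have 1: "L [u, v, z, y] = L [u, v, z] \<inter> L [y]"
    using V y yV by (intro L_combine[where x = y]) (auto simp: L_single)
  have "d v y = Suc (d u y)"
    using lt gdist_triangle[of y u v] V yV uv gdist_sym[of y u] gdist_sym[of y v] by simp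
  then have "u \<in> L [v, y]"
    using V yV uv gdist_sym[of u v] by (simp add: L_pair interval_def)
  moreover have "u \<in> L [z, u]"
    using V by (simp add: L_pair interval_ends)
  ultimately have "u \<in> L [u, v, z, y]"
    using L_combine[of "[u, v, z, y]" "[v, y]" "[z, u]" u] V yV by auto
  with 1 ne yV show False
    by (simp add: L_single)
qed

text \<open>By the preceding lemma \<open>y\<close> is equidistant from \<open>u\<close> and
  \<open>v\<close>, so they have a common neighbour \<open>x\<close> closer to \<open>y\<close>. If
  \<open>x\<close> is not \<open>y\<close>, then \<open>[u, v, z, y, x, y]\<close> has value
  \<open>{y}\<close>, yet it splits into \<open>[u, y]\<close>, \<open>[v, y]\<close> and
  \<open>[x, z]\<close>, whose values all contain \<open>x\<close>.\<close>

lemma L_triple_adjacent: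
  assumes V: "u \<in> V" "v \<in> V" "z \<in> V" and uv: "d u v = 1"
    and y: "y \<in> L [u, v, z]" and ne: "y \<noteq> u" "y \<noteq> v"
  shows "d y u = 1" "d y v = 1"
proof -
  have yV: "y \<in> V"
    using L_subset[of "[u, v, z]"] V y by auto
  have vu: "d v u = 1"
    using uv V gdist_sym by metis
  have "L [u, v, z] = L [v, u, z]"
    using V by (intro L_mset_cong) auto
  then have a: "d y u = d y v"
    using L_triple_dist_le[of u v z y] L_triple_dist_le[of v u z y] assms vu by auto
  then have a': "d u y = d v y"
    using V yV gdist_sym by metis
  obtain x where x: "x \<in> V" "d u x = 1" "d v x = 1" "Suc (d x y) = d u y"
    using triangle_condition[OF V(1,2) yV uv a'] .
  have "x = y"
  proof (rule ccontr)
    assume xy: "x \<noteq> y"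
    have 1: "L [u, v, z, y, x] = L [u, v, z] \<inter> L [y, x]"
      using V yV y x by (intro L_combine[where x = y]) (auto simp: L_pair interval_ends)
    have y1: "y \<in> L [u, v, z, y, x]"
      unfolding 1 using y yV x by (simp add: L_pair interval_ends)
    have 2: "L [u, v, z, y, x, y] = L [u, v, z, y, x] \<inter> L [y]"
      using V yV x y1 by (intro L_combine[where x = y]) (auto simp: L_single)
    have xs: "x \<in> L [u, y]" "x \<in> L [v, y]" "x \<in> L [x, z]"
      using V yV x a' by (auto simp: L_pair interval_ends) (auto simp: interval_def)
    have 3: "L [u, y, v, y] = L [u, y] \<inter> L [v, y]"
      using V yV xs by (intro L_combine[where x = x]) auto
    have "L [u, v, z, y, x, y] = L [u, y, v, y] \<inter> L [x, z]"
      using V yV x xs 3 by (intro L_combine[where x = x]) auto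
    with 2 3 xs xy yV show False
      by (auto simp: L_single)
  qed
  with x V yV gdist_sym show "d y u = 1" "d y v = 1"
    by metis+
qed

text \<open>The hypothesis \<open>dich\<close> is first verified for \<open>k = 1\<close>, where it is the weak triangle axiom;
  the resulting conclusion for \<open>k = 1\<close> then yields it for all \<open>k\<close>.\<close>

lemma L_triple_equidistant_aux:
  assumes z: "z \<in> V"
    and dich: "\<And>u v w. \<lbrakk>u \<in> V; v \<in> V; w \<in> V; d u v = 1; d u w = 1; d v w = 1; d u z = k; d v z = k;
       Suc (d w z) = k; L [u, v, z] \<inter> {u, v, w} \<noteq> {}\<rbrakk> \<Longrightarrow> {u, v} \<subseteq> L [u, v, z]"
    and uv: "u \<in> V" "v \<in> V" "d u v = 1" "d u z = k" "d v z = k"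
  shows "{u, v} \<subseteq> L [u, v, z]"
proof (rule ccontr)
  have dich2: "{u, v} \<subseteq> L [u, v, z]"
    if a: "u \<in> V" "v \<in> V" "d u v = 1" "d u z = k" "d v z = k" "L [u, v, z] \<inter> {u, v} \<noteq> {}" for u v
  proof -
    obtain w where "w \<in> V" "d u w = 1" "d v w = 1" "Suc (d w z) = d u z"
      using triangle_condition[of u v z] a z by metis
    with a show ?thesis
      by (intro dich[of u v w]) auto
  qed
  assume "\<not> ?thesis"
  with dich2[of u v] uv have un: "u \<notin> L [u, v, z]" "v \<notin> L [u, v, z]" by auto
  obtain y where y: "y \<in> L [u, v, z]"
    using L_nonempty[of "[u, v, z]"] uv z by auto
  then have yV: "y \<in> V"
    using L_subset[of "[u, v, z]"] uv z by auto
  have yn: "y \<noteq> u" "y \<noteq> v" using y un by auto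
  have dy: "d y u = 1" "d y v = 1"
    using L_triple_adjacent[of u v z y] uv z y yn by auto
  then have dy': "d u y = 1" "d v y = 1"
    using uv yV gdist_sym by metis+
  \<comment> \<open>If \<open>y\<close> were farther from \<open>z\<close>, then \<open>u\<close>
    would lie between \<open>z\<close> and \<open>y\<close> and enter the value \<open>{y}\<close>
    of \<open>[u, v, z, y]\<close>. If nearer, \<open>y\<close> could serve as \<open>w\<close> in
    \<open>dich\<close>.\<close>
  have dyz: "d y z = k"
  proof (rule ccontr)
    assume "d y z \<noteq> k"
    moreover have "d y z \<le> Suc k" "k \<le> Suc (d y z)"
      using gdist_triangle[of y u z] gdist_triangle[of u y z] uv yV z dy dy' by auto
    ultimately consider "d y z = Suc k" | "Suc (d y z) = k" by linarith
    then show False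
    proof cases
      case 1
      have 2: "L [u, v, z, y] = L [u, v, z] \<inter> L [y]"
        using uv z y yV by (intro L_combine[where x = y]) (auto simp: L_single)
      have "u \<in> L [z, y]" "u \<in> L [u, v]"
        using 1 uv yV z dy' gdist_sym[of z u] gdist_sym[of z y]
        by (auto simp: L_pair interval_ends) (auto simp: interval_def)
      then have "u \<in> L [u, v, z, y]"
        using L_combine[of "[u, v, z, y]" "[u, v]" "[z, y]" u] uv yV z by auto
      with 2 yn yV show False
        by (simp add: L_single)
    next
      case 2
      have "{u, v} \<subseteq> L [u, v, z]"
        using uv yV dy' 2 y by (intro dich[of u v y]) auto
      with un show False by simp
    qed
  qed
  \<comment> \<open>The edge \<open>uy\<close> is again equidistant from \<open>z\<close>, so
    \<open>y\<close> would bring \<open>u\<close> into \<open>L [u, y, z]\<close>, and the two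
    splittings of \<open>[u, v, z, u, y]\<close> would put \<open>u\<close> into
    \<open>L [u, v, z]\<close>.\<close>
  have y_notin: "y \<notin> L [u, y, z]"
  proof
    assume "y \<in> L [u, y, z]"
    then have u_in: "u \<in> L [u, y, z]"
      using dich2[of u y] uv yV dy' dyz by auto
    have 1: "L [u, v, z, u, y] = L [u, v, z] \<inter> L [u, y]"
      using uv z y yV by (intro L_combine[where x = y]) (auto simp: L_pair interval_ends)
    have "u \<in> L [u, v]"
      using uv by (simp add: L_pair interval_ends)
    with u_in have "u \<in> L [u, v, z, u, y]"
      using L_combine[of "[u, v, z, u, y]" "[u, y, z]" "[u, v]" u] uv z yV by auto
    with 1 un show False by blast
  qed
  obtain t where t: "t \<in> L [u, y, z]"
    using L_nonempty[of "[u, y, z]"] uv z yV by auto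
  then have tV: "t \<in> V"
    using L_subset[of "[u, y, z]"] uv z yV by auto
  \<comment> \<open>The first splitting keeps \<open>y\<close> in the value, the second confines the
    value to \<open>L [u, y, z]\<close>, which omits \<open>y\<close>.\<close>
  have 1: "L [u, v, z, y, t] = L [u, v, z] \<inter> L [y, t]"
    using uv z y yV tV by (intro L_combine[where x = y]) (auto simp: L_pair interval_ends)
  have 2: "L [u, v, z, y, t] = L [u, y, z] \<inter> L [v, t]"
    using uv z t yV tV by (intro L_combine[where x = t]) (auto simp: L_pair interval_ends)
  have "y \<in> L [y, t]"
    using yV tV by (simp add: L_pair interval_ends)
  with 1 2 y y_notin show False by blast
qed

text \<open>For \<open>k = 1\<close> the third vertex in \<open>dich\<close> has distance 0 from
  \<open>w\<close> and so equals \<open>w\<close>.\<close>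

lemma L_triangle:
  assumes "u \<in> V" "v \<in> V" "w \<in> V" "d u v = 1" "d v w = 1" "d u w = 1"
  shows "{u, v, w} \<subseteq> L [u, v, w]"
proof -
  have "{u, v} \<subseteq> L [u, v, w]"
  proof (rule L_triple_equidistant_aux[of w 1])
    fix u v x
    assume a: "u \<in> V" "v \<in> V" "x \<in> V" "d u v = 1" "d u w = 1" "d v w = 1" "Suc (d x w) = 1"
      "L [u, v, w] \<inter> {u, v, x} \<noteq> {}"
    then have "x = w"
      using assms gdist_eq_0 by auto
    with a show "{u, v} \<subseteq> L [u, v, w]"
      using L_weak_triangle[of u v w] assms by auto
  qed (use assms in auto)
  then show ?thesis
    using L_weak_triangle[of u v w] assms by auto
qed

lemma L_triple_equidistant:
  assumes "u \<in> V" "v \<in> V" "z \<in> V" "d u v = 1" "d u z = d v z"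
  shows "{u, v} \<subseteq> L [u, v, z]"
proof (rule L_triple_equidistant_aux[of z "d u z"])
  fix u' v' w
  assume a: "u' \<in> V" "v' \<in> V" "w \<in> V" "d u' v' = 1" "d u' w = 1" "d v' w = 1"
    "d u' z = d u z" "d v' z = d u z" "Suc (d w z) = d u z" "L [u', v', z] \<inter> {u', v', w} \<noteq> {}"
  \<comment> \<open>Two splittings of \<open>[a, b, z, a, w]\<close> are compared:
    \<open>[a, b, w]\<close> and \<open>[a, z]\<close> both admit \<open>a\<close> and
    \<open>w\<close>, since \<open>w\<close> lies between \<open>a\<close> and \<open>z\<close>; the
    other splitting carries this over to \<open>[a, b, z]\<close>.\<close>
  have main: "a \<in> L [a, b, z] \<and> w \<in> L [a, b, z]"
    if ab: "a \<in> V" "b \<in> V" "d a b = 1" "d a w = 1" "d b w = 1" "d a z = d u z"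
      and x: "x \<in> {a, w}" "x \<in> L [a, b, z]" for a b x
  proof -
    have 1: "{a, b, w} \<subseteq> L [a, b, w]"
      using L_triangle[of a b w] ab a by auto
    have 2: "{a, w} \<subseteq> L [a, z]"
      using ab a assms by (auto simp: L_pair interval_ends) (auto simp: interval_def)
    have 3: "L [a, b, z, a, w] = L [a, b, w] \<inter> L [a, z]"
      using ab a 1 2 assms by (intro L_combine[where x = a]) auto
    have "L [a, b, z, a, w] = L [a, b, z] \<inter> L [a, w]"
      using ab a x assms by (intro L_combine[where x = x]) (auto simp: L_pair interval_ends)
    with 1 2 3 show ?thesis by blast
  qed
  have sw: "L [u', v', z] = L [v', u', z]"
    using a assms by (intro L_mset_cong) auto
  have vu: "d v' u' = 1"
    using a gdist_sym by metis
  have main1: "u' \<in> L [u', v', z] \<and> w \<in> L [u', v', z]" if "x \<in> {u', w}" "x \<in> L [u', v', z]" for x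
    using main[of u' v' x] a that by blast
  have main2: "v' \<in> L [u', v', z] \<and> w \<in> L [u', v', z]" if "x \<in> {v', w}" "x \<in> L [u', v', z]" for x
    unfolding sw using main[of v' u' x] a vu that[unfolded sw] by blast
  \<comment> \<open>The vertex \<open>w\<close> passes membership from one end of the edge to the
    other.\<close>
  show "{u', v'} \<subseteq> L [u', v', z]"
    using a(10) main1 main2 by blast
qed (use assms in auto)

section \<open>Comparing the two ends of an edge\<close>

text \<open>Completing each \<open>x \<in> \<pi>\<close> by \<open>v\<close>, \<open>u\<close> or \<open>u, v\<close>, according to which end of the edge is nearer, gives
  profiles whose \<open>L\<close> contains both ends. The completing vertices form a profile over \<open>{u, v}\<close> in which
  the surplus of \<open>u\<close> over \<open>v\<close> is \<open>F \<pi> u - F \<pi> v\<close>.\<close>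

lemma completion_exists:
  assumes V: "u \<in> V" "v \<in> V" and uv: "d u v = 1" and \<pi>: "\<pi> \<in> lists V"
  shows "\<exists>a b. {u, v} \<subseteq> L (\<pi> @ replicate a u @ replicate b v) \<and> F \<pi> u + b = F \<pi> v + a"
  using \<pi>
proof (induct \<pi>)
  case Nil
  show ?case
    using V by (intro exI[of _ 0]) (auto simp: L_Nil)
next
  case (Cons x \<pi>)
  then have x: "x \<in> V" and \<pi>: "\<pi> \<in> lists V" by auto
  obtain a b where ab: "{u, v} \<subseteq> L (\<pi> @ replicate a u @ replicate b v)" "F \<pi> u + b = F \<pi> v + a"
    using Cons by auto
  have step: "{u, v} \<subseteq> L ((x # \<pi>) @ replicate (a + a') u @ replicate (b + b') v)"
    if "{u, v} \<subseteq> L (replicate a' u @ replicate b' v @ [x])" for a' b'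
  proof -
    have "L ((x # \<pi>) @ replicate (a + a') u @ replicate (b + b') v) =
        L (\<pi> @ replicate a u @ replicate b v) \<inter> L (replicate a' u @ replicate b' v @ [x])"
    proof (rule L_combine[where x = u])
      show "(x # \<pi>) @ replicate (a + a') u @ replicate (b + b') v \<in> lists V"
        using V x \<pi> by auto
    qed (use ab that in \<open>auto simp: replicate_add\<close>)
    with ab that show ?thesis by simp
  qed
  have vu: "d v u = 1"
    using V uv gdist_sym by metis
  have "d v x \<le> Suc (d u x)" "d u x \<le> Suc (d v x)"
    using gdist_triangle[of u v x] gdist_triangle[of v u x] V x uv vu by auto
  then consider "d v x = Suc (d u x)" | "d u x = Suc (d v x)" | "d u x = d v x" by linarith
  then show ?case
  proof cases
    case 1
    then have "{u, v} \<subseteq> L [v, x]"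
      using V x vu by (auto simp: L_pair interval_ends) (auto simp: interval_def)
    then show ?thesis
      using step[of 0 1] ab 1 by (intro exI[of _ a] exI[of _ "b + 1"]) auto
  next
    case 2
    then have "{u, v} \<subseteq> L [u, x]"
      using V x uv by (auto simp: L_pair interval_ends) (auto simp: interval_def)
    then show ?thesis
      using step[of 1 0] ab 2 by (intro exI[of _ "a + 1"] exI[of _ b]) auto
  next
    case 3
    then have "{u, v} \<subseteq> L [u, v, x]"
      using L_triple_equidistant V x uv by auto
    then show ?thesis
      using step[of 1 1] ab 3 by (intro exI[of _ "a + 1"] exI[of _ "b + 1"]) auto
  qed
qed

lemma L_edge_profile:
  assumes V: "u \<in> V" "v \<in> V" and uv: "d u v = 1"
  shows "L (replicate (b + c) u @ replicate b v) = (if b + c = 0 then V else if c = 0 then {u, v} else {u})"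
proof -
  have edge: "L (replicate b u @ replicate b v) = (if b = 0 then V else {u, v})" for b
  proof (induct b)
    case (Suc b)
    have "L (replicate (Suc b) u @ replicate (Suc b) v) = L (replicate b u @ replicate b v) \<inter> L [u, v]"
      using V Suc by (intro L_combine[where x = u]) (auto simp: L_pair interval_ends)
    with Suc V uv show ?case
      by (auto simp: L_pair interval_adjacent)
  qed (simp add: L_Nil)
  show ?thesis
  proof (induct c)
    case (Suc c)
    have "L (replicate (b + Suc c) u @ replicate b v) = L (replicate (b + c) u @ replicate b v) \<inter> L [u]"
      using V Suc by (intro L_combine[where x = u]) (auto simp: L_single)
    with Suc V show ?case
      by (auto simp: L_single)
  qed (simp add: edge)
qed

text \<open>Both \<open>\<pi>\<close> and its completing profile have \<open>u\<close> in their
  values, so by consistency both have \<open>v\<close> as well. A positive surplus \<open>c\<close>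
  of \<open>u\<close> in the completing profile would exclude \<open>v\<close>.\<close>

lemma L_exchange:
  assumes V: "u \<in> V" "v \<in> V" and uv: "d u v = 1" and \<pi>: "\<pi> \<in> lists V"
    and u: "u \<in> L \<pi>" and le: "F \<pi> v \<le> F \<pi> u"
  shows "v \<in> L \<pi> \<and> F \<pi> v = F \<pi> u"
proof -
  obtain a b where ab: "{u, v} \<subseteq> L (\<pi> @ replicate a u @ replicate b v)" "F \<pi> u + b = F \<pi> v + a"
    using completion_exists[OF V uv \<pi>] by blast
  define c where "c = a - b"
  have a: "a = b + c"
    using ab le by (simp add: c_def)
  let ?\<rho> = "replicate a u @ replicate b v"
  have "u \<in> L ?\<rho>"
    unfolding a L_edge_profile[OF V uv] using V by simp
  then have "L (\<pi> @ ?\<rho>) = L \<pi> \<inter> L ?\<rho>"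
    using u V \<pi> by (intro L_append) auto
  with ab have v: "v \<in> L \<pi>" "v \<in> L ?\<rho>" by auto
  have "u \<noteq> v"
    using uv V by auto
  with v(2) have "c = 0"
    unfolding a L_edge_profile[OF V uv] by (auto split: if_splits)
  with v ab a show ?thesis by simp
qed

lemma L_eq_Med:
  assumes \<pi>: "\<pi> \<in> lists V"
  shows "L \<pi> = M \<pi>"
proof -
  have sub: "L \<pi> \<subseteq> M \<pi>"
  proof
    fix u assume u: "u \<in> L \<pi>"
    then have uV: "u \<in> V"
      using L_subset[OF \<pi>] by auto
    show "u \<in> M \<pi>"
    proof (rule local_min_is_median[OF \<pi> uV])
      fix v assume "v \<in> V" "d u v = 1"
      then show "F \<pi> u \<le> F \<pi> v"
        using L_exchange[of u v \<pi>] u uV \<pi> by fastforce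
    qed
  qed
  obtain x where x: "x \<in> L \<pi>"
    using L_nonempty[OF \<pi>] by auto
  have "y \<in> L \<pi>" if "y \<in> M \<pi>" for y
  proof (rule Med_propagate[OF \<pi> _ _ that, where x = x and P = "\<lambda>y. y \<in> L \<pi>"])
    fix u v assume "u \<in> M \<pi>" "v \<in> M \<pi>" "d u v = 1" "u \<in> L \<pi>"
    then show "v \<in> L \<pi>"
      using L_exchange[of u v \<pi>] \<pi> by (auto simp: Med_def)
  qed (use x sub in auto)
  with sub show ?thesis by auto
qed

end

theorem theorem10:
  fixes V :: "'a set" and E :: "'a set set"
  assumes "simple_graph V E"
    and "connected_graph V E"
    and "connected_medians V E"
  shows "ABCT_graph V E \<and> ABCT_minus_graph V E"
proof -
  interpret conn_median_graph V E
    using assms by unfold_locales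
  have Med: "ABCT_function V E M"
    using Med_consensus Med_anonymity Med_betweenness Med_consistency Med_triangle
    by (simp add: ABCT_function_def)
  \<comment> \<open>The triangle axiom implies the weak one, so one uniqueness proof serves both
    claims.\<close>
  have minus: "ABCT_minus_function V E L" if "ABCT_function V E L" for L
    using that triangle_imp_weak_triangle by (simp add: ABCT_function_def ABCT_minus_function_def)
  have unique: "L \<pi> = M \<pi>" if "ABCT_minus_function V E L" "\<pi> \<in> lists V" for L \<pi>
  proof -
    interpret ABCT_minus_consensus V E L
      using that(1) by unfold_locales
    show ?thesis
      using L_eq_Med that(2) .
  qed
  show ?thesis
    unfolding ABCT_graph_def ABCT_minus_graph_def using Med minus unique by blast
qed

end
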